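(* Let $M\in\mathbb{R}^{n\times n}$ be a lower Hessenberg P-matrix, and let $q\in\mathbb{R}^n$ be such that $\mathrm{LCP}(M,q)$ is nondegenerate. The optimal basis $\tilde B=B(n)$ of $\mathrm{LCP}(M,q)$ can be found with at most $\binom{n+1}{2}$ basis tests.
   Context: Write $[n]=\{1,\dots,n\}$. For $M\in\mathbb{R}^{n\times n}$ and $q\in\mathbb{R}^n$, the linear complementarity problem $\mathrm{LCP}(M,q)$ is to find $w,z\in\mathbb{R}^n$ with $w-Mz=q$, $w,z\ge 0$ (componentwise), $w^Tz=0$. $M$ is a P-matrix if all its principal minors are positive. $M=(m_{ij})$ is lower Hessenberg if $m_{ij}=0$ whenever $j-i>1$. For $B\subseteq[n]$ (called a basis), $\overline{M}_B$ is the $n\times n$ matrix whose $i$th column is the $i$th column of $-M$ if $i\in B$, and the $i$th column of the identity matrix $I_n$ otherwise; it is invertible when $M$ is a P-matrix. The basis $B$ is optimal for $\mathrm{LCP}(M,q)$ if $\overline{M}_B^{-1}q\ge 0$; equivalently, if the pair $(w(B),z(B))$, defined by $w_i(B)=0$, $z_i(B)=(\overline{M}_B^{-1}q)_i$ for $i\in B$ and $w_i(B)=(\overline{M}_B^{-1}q)_i$, $z_i(B)=0$ for $i\notin B$, solves $\mathrm{LCP}(M,q)$. $\mathrm{LCP}(M,q)$ is nondegenerate if $(\overline{M}_B^{-1}q)_i\neq 0$ for all $B\subseteq[n]$ and all $i\in[n]$; for a P-matrix $M$ there is then exactly one optimal basis, denoted $\tilde B$. For $k\in[n]$, $B(k)\subseteq[k]$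 denotes the unique optimal basis of $\mathrm{LCP}(M_{[k][k]},q_{[k]})$, where $M_{[k][k]}$ is the leading principal $k\times k$ submatrix of $M$ and $q_{[k]}$ consists of the first $k$ entries of $q$ (this subproblem again has a P-matrix and is nondegenerate); thus $\tilde B=B(n)$. A basis test is a procedure to decide whether a given basis $B\subseteq[n]$ is optimal for $\mathrm{LCP}(M,q)$. A basis test can be implemented in polynomial time using Gaussian elimination, and the number of basis tests is used as the measure of algorithmic complexity. *)

theory Defs
  imports
    "Jordan_Normal_Form.Determinant"
    "Jordan_Normal_Form.Gauss_Jordan_Elimination"
    "Jordan_Normal_Form.DL_Submatrix"
begin

text \<open>Rows, columns and entries are numbered from 0, as in the matrix library, so the index set
  \<open>[k]\<close> is \<open>{..<k}\<close>.\<close>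

definition P_matrix :: "real mat \<Rightarrow> bool" where
  "P_matrix M \<longleftrightarrow> square_mat M \<and>
     (\<forall>I. I \<noteq> {} \<and> I \<subseteq> {..<dim_row M} \<longrightarrow> det (submatrix M I I) > 0)"

definition lower_Hessenberg :: "real mat \<Rightarrow> bool" where
  "lower_Hessenberg M \<longleftrightarrow> square_mat M \<and>
     (\<forall>i < dim_row M. \<forall>j < dim_col M. i + 1 < j \<longrightarrow> M $$ (i, j) = 0)"

definition LCP_solution :: "real mat \<Rightarrow> real vec \<Rightarrow> real vec \<Rightarrow> real vec \<Rightarrow> bool" where
  "LCP_solution M q w z \<longleftrightarrow>
     w \<in> carrier_vec (dim_vec q) \<and> z \<in> carrier_vec (dim_vec q) \<and>
     w - M *\<^sub>v z = q \<and> 0\<^sub>v (dim_vec q) \<le> w \<and> 0\<^sub>v (dim_vec q) \<le> z \<and> w \<bullet> z = 0"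

definition basis_mat :: "real mat \<Rightarrow> nat set \<Rightarrow> real mat" where
  "basis_mat M B = mat (dim_row M) (dim_row M)
     (\<lambda>(i, j). if j \<in> B then - (M $$ (i, j)) else 1\<^sub>m (dim_row M) $$ (i, j))"

text \<open>\<^const>\<open>mat_inverse\<close> is option-valued; the basis matrices of a P-matrix are all invertible,
  so \<^const>\<open>the\<close> is only applied to a proper inverse there.\<close>

definition basis_vec :: "real mat \<Rightarrow> real vec \<Rightarrow> nat set \<Rightarrow> real vec" where
  "basis_vec M q B = the (mat_inverse (basis_mat M B)) *\<^sub>v q"

definition optimal_basis :: "real mat \<Rightarrow> real vec \<Rightarrow> nat set \<Rightarrow> bool" where
  "optimal_basis M q B \<longleftrightarrow> B \<subseteq> {..<dim_row M} \<and> 0\<^sub>v (dim_row M) \<le> basis_vec M q B"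

lemma optimal_basis_iff_LCP_solution:
  assumes M: "M \<in> carrier_mat n n" and q: "q \<in> carrier_vec n" and B: "B \<subseteq> {..<n}"
    and inv: "mat_inverse (basis_mat M B) \<noteq> None"
  shows "optimal_basis M q B \<longleftrightarrow> LCP_solution M q
    (vec n (\<lambda>i. if i \<in> B then 0 else basis_vec M q B $ i))
    (vec n (\<lambda>i. if i \<in> B then basis_vec M q B $ i else 0))"
    (is "_ \<longleftrightarrow> LCP_solution M q ?w ?z")
proof -
  let ?A = "basis_mat M B" and ?x = "basis_vec M q B"
  have A: "?A \<in> carrier_mat n n"
    using M by (auto simp: basis_mat_def)
  obtain C where C: "mat_inverse ?A = Some C"
    using inv by auto
  have AC: "?A * C = 1\<^sub>m n" and Cc: "C \<in> carrier_mat n n"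
    using mat_inverse(2)[OF A C] by auto
  have x: "?x \<in> carrier_vec n"
    using C Cc q by (simp add: basis_vec_def)
  have "?A *\<^sub>v ?x = (?A * C) *\<^sub>v q"
    unfolding basis_vec_def C option.sel by (rule assoc_mult_mat_vec[symmetric, OF A Cc q])
  then have Ax: "?A *\<^sub>v ?x = q"
    using AC q by simp
  have "?w - M *\<^sub>v ?z = ?A *\<^sub>v ?x"
  proof (rule eq_vecI)
    fix i assume "i < dim_vec (?A *\<^sub>v ?x)"
    then have i: "i < n" using A by simp
    have "(?w - M *\<^sub>v ?z) $ i =
        (\<Sum>j\<in>{0..<n}. (if j = i then ?w $ i else 0) - M $$ (i, j) * ?z $ j)"
      using i M by (simp add: scalar_prod_def sum_subtractf)
    also have "\<dots> = (\<Sum>j\<in>{0..<n}. ?A $$ (i, j) * ?x $ j)"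
      using i M by (intro sum.cong) (auto simp: basis_mat_def)
    also have "\<dots> = (?A *\<^sub>v ?x) $ i"
      using i A x by (simp add: scalar_prod_def)
    finally show "(?w - M *\<^sub>v ?z) $ i = (?A *\<^sub>v ?x) $ i" .
  qed (use A M in simp)
  then have "?w - M *\<^sub>v ?z = q"
    using Ax by simp
  moreover have "?w \<bullet> ?z = 0"
    by (auto simp: scalar_prod_def intro: sum.neutral)
  moreover have "0\<^sub>v n \<le> ?x \<longleftrightarrow> 0\<^sub>v n \<le> ?w \<and> 0\<^sub>v n \<le> ?z"
  proof -
    have "(\<forall>i<n. 0 \<le> ?x $ i) \<longleftrightarrow>
        (\<forall>i<n. 0 \<le> ?w $ i) \<and> (\<forall>i<n. 0 \<le> ?z $ i)"
      by (simp cong: imp_cong) (smt (verit))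
    then show ?thesis
      using x by (simp add: less_eq_vec_def)
  qed
  ultimately show ?thesis
    using M q B by (auto simp: optimal_basis_def LCP_solution_def)
qed

definition nondegenerate :: "real mat \<Rightarrow> real vec \<Rightarrow> bool" where
  "nondegenerate M q \<longleftrightarrow>
     (\<forall>B \<subseteq> {..<dim_row M}. \<forall>i < dim_row M. basis_vec M q B $ i \<noteq> 0)"

definition leading_mat :: "nat \<Rightarrow> real mat \<Rightarrow> real mat" where
  "leading_mat k M = mat k k (\<lambda>(i, j). M $$ (i, j))"

text \<open>\<open>opt_basis M q k\<close> is \<open>B(k)\<close>; its existence and uniqueness hold for nondegenerate LCPs with
  a P-matrix.\<close>

definition opt_basis :: "real mat \<Rightarrow> real vec \<Rightarrow> nat \<Rightarrow> nat set" where
  "opt_basis M q k = (THE B. optimal_basis (leading_mat k M) (vec_first q k) B)"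

text \<open>Query model. The only information an algorithm obtains about \<open>M\<close> and \<open>q\<close> are the answers to
  its basis tests; the test \<open>(k, B)\<close> asks whether \<open>B\<close> is optimal for the leading subproblem of
  size \<open>k\<close>, where \<open>k = n\<close> is the problem itself. Tests with \<open>k > n\<close> or not \<open>B \<subseteq> [k]\<close> are always
  answered negatively.\<close>

definition basis_test :: "real mat \<Rightarrow> real vec \<Rightarrow> nat \<Rightarrow> nat set \<Rightarrow> bool" where
  "basis_test M q k B \<longleftrightarrow>
     k \<le> dim_row M \<and> optimal_basis (leading_mat k M) (vec_first q k) B"

text \<open>An adaptive algorithm is a decision tree: \<open>Test k B a b\<close> continues with \<open>a\<close> if the test
  succeeds and with \<open>b\<close> if it fails.\<close>

datatype test_algorithm =
    Output "nat set"
  | Test nat "nat set" test_algorithm test_algorithm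

primrec run :: "test_algorithm \<Rightarrow> (nat \<Rightarrow> nat set \<Rightarrow> bool) \<Rightarrow> nat set" where
  "run (Output B) test = B"
| "run (Test k B a b) test = (if test k B then run a test else run b test)"

primrec num_tests :: "test_algorithm \<Rightarrow> (nat \<Rightarrow> nat set \<Rightarrow> bool) \<Rightarrow> nat" where
  "num_tests (Output B) test = 0"
| "num_tests (Test k B a b) test =
     Suc (if test k B then num_tests a test else num_tests b test)"

end

theory Submission
  imports Defs
begin

text \<open>Solve the leading subproblems of size \<open>k = 1, \<dots>, n\<close> in turn. If \<open>l\<close> is the largest nonbasic
  index of \<open>B(k)\<close>, then by the Hessenberg shape the variables after \<open>l\<close> do not occur in the
  equations before \<open>l\<close>, so \<open>B(k)\<close> consists of the optimal basis of the subproblem before \<open>l\<close>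
  together with all indices after \<open>l\<close>. This leaves \<open>k\<close> candidates besides \<open>[k]\<close>, and \<open>k\<close> tests
  identify \<open>B(k)\<close>. That \<open>B(k)\<close> exists and is unique is shown by counting: by the sign reversal
  property of P-matrices the map from a basis to the set of its negative variables is injective,
  hence a bijection on the subsets of \<open>[k]\<close>, and the empty set is attained exactly once.\<close>

section \<open>Principal minors\<close>

text \<open>Replacing the rows outside \<open>I\<close> by unit rows gives all principal minors as determinants of the
  same dimension, without reindexing.\<close>

definition principal_mask :: "'a :: {zero, one} mat \<Rightarrow> nat set \<Rightarrow> 'a mat" where
  "principal_mask M I = mat (dim_row M) (dim_row M)
     (\<lambda>(i, j). if i \<in> I then M $$ (i, j) else if i = j then 1 else 0)"

lemma principal_mask_carrier [simp]:
  "M \<in> carrier_mat n n \<Longrightarrow> principal_mask M I \<in> carrier_mat n n"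
  by (auto simp: principal_mask_def)

lemma index_principal_mask [simp]:
  "M \<in> carrier_mat n n \<Longrightarrow> i < n \<Longrightarrow> j < n \<Longrightarrow>
    principal_mask M I $$ (i, j) = (if i \<in> I then M $$ (i, j) else if i = j then 1 else 0)"
  by (auto simp: principal_mask_def)

text \<open>In the Leibniz formula, a permutation that moves an index outside \<open>I\<close> picks
  an off-diagonal zero of a unit row. The others permute \<open>I\<close> and contribute only
  factors 1 outside it.\<close>

lemma det_principal_mask_sum:
  assumes M: "M \<in> carrier_mat n n" and I: "I \<subseteq> {..<n}"
  shows "det (principal_mask M I) =
    (\<Sum>p | p permutes I. signof p * (\<Prod>i\<in>I. M $$ (i, p i)))"
proof -
  let ?f = "\<lambda>p. signof p * (\<Prod>i = 0..<n. principal_mask M I $$ (i, p i))"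
  have "det (principal_mask M I) = (\<Sum>p | p permutes {0..<n}. ?f p)"
    by (rule det_def') (use M in simp)
  also have "\<dots> = (\<Sum>p | p permutes I. ?f p)"
  proof (rule sum.mono_neutral_right)
    show "finite {p. p permutes {0..<n}}"
      by (simp add: finite_permutations)
    show "{p. p permutes I} \<subseteq> {p. p permutes {0..<n}}"
      using I by (auto intro: permutes_subset simp: atLeast0LessThan)
    show "\<forall>p\<in>{p. p permutes {0..<n}} - {p. p permutes I}. ?f p = 0"
    proof
      fix p assume p: "p \<in> {p. p permutes {0..<n}} - {p. p permutes I}"
      then obtain i where i: "i < n" "i \<notin> I" "p i \<noteq> i"
        using permutes_superset[of p "{0..<n}" I] by fastforce
      moreover have "p i < n"
        using p i permutes_in_image[of p "{0..<n}" i] by simp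
      ultimately have "principal_mask M I $$ (i, p i) = 0"
        using M by simp
      then have "(\<Prod>i = 0..<n. principal_mask M I $$ (i, p i)) = 0"
        using i by (intro prod_zero) auto
      then show "?f p = 0"
        by simp
    qed
  qed
  also have "\<dots> = (\<Sum>p | p permutes I. signof p * (\<Prod>i\<in>I. M $$ (i, p i)))"
  proof (rule sum.cong[OF refl])
    fix p assume p: "p \<in> {p. p permutes I}"
    have "(\<Prod>i = 0..<n. principal_mask M I $$ (i, p i)) =
        (\<Prod>i\<in>I. principal_mask M I $$ (i, p i))"
      using p I M
      by (intro prod.mono_neutral_right) (auto simp: permutes_not_in)
    also have "\<dots> = (\<Prod>i\<in>I. M $$ (i, p i))"
    proof (rule prod.cong[OF refl])
      fix i assume "i \<in> I"
      moreover from this have "p i \<in> I"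
        using p permutes_in_image by fastforce
      ultimately show "principal_mask M I $$ (i, p i) = M $$ (i, p i)"
        using I M by (simp add: subset_iff)
    qed
    finally show "?f p = signof p * (\<Prod>i\<in>I. M $$ (i, p i))"
      by simp
  qed
  finally show ?thesis .
qed

text \<open>Both sides are Leibniz sums. Conjugation with \<open>pick I\<close>, the increasing
  enumeration of \<open>I\<close>, matches their permutations and preserves signs.\<close>

lemma det_submatrix_eq_det_principal_mask:
  assumes M: "M \<in> carrier_mat n n" and I: "I \<subseteq> {..<n}"
  shows "det (submatrix M I I) = det (principal_mask M I)"
proof -
  let ?m = "card I" and ?f = "pick I"
  have fin: "finite I" and eq: "{i. i < n \<and> i \<in> I} = I"
    using I finite_subset by auto
  have dims: "submatrix M I I \<in> carrier_mat ?m ?m"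
    using M eq by (intro carrier_matI) (auto simp: dim_submatrix)
  have inj: "inj_on ?f {0..<?m}"
    by (rule linorder_inj_onI) (use pick_mono_le[of _ I] in \<open>auto, fastforce\<close>)
  have img: "?f ` {0..<?m} = I"
    using pick_in_set_le[of _ I] inj fin by (intro card_subset_eq) (auto simp: card_image)
  have bij: "bij_betw ?f {0..<?m} I"
    using inj img by (simp add: bij_betw_def)
  let ?g = "inv_into {0..<?m} ?f"
  have bij': "bij_betw ?g I {0..<?m}"
    using bij by (rule bij_betw_inv_into)
  have "det (submatrix M I I) = (\<Sum>p | p permutes {0..<?m}.
      signof p * (\<Prod>i = 0..<?m. submatrix M I I $$ (i, p i)))"
    using dims by (rule det_def')
  also have "\<dots> = (\<Sum>p | p permutes I. signof p * (\<Prod>i\<in>I. M $$ (i, p i)))"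
  proof (rule sum.reindex_bij_witness[of _ "map_permutation I ?g" "map_permutation {0..<?m} ?f"])
    fix p assume "p \<in> {p. p permutes {0..<?m}}"
    then have p: "p permutes {0..<?m}" by simp
    let ?p = "map_permutation {0..<?m} ?f p"
    show "map_permutation I ?g ?p = p"
      using map_permutation_compose_inv[OF bij p, of ?g] inj by simp
    show "?p \<in> {p. p permutes I}"
      using map_permutation_permutes[OF bij p] by simp
    have "(\<Prod>i\<in>I. M $$ (i, ?p i)) = (\<Prod>i = 0..<?m. M $$ (?f i, ?p (?f i)))"
      by (rule prod.reindex_bij_betw[OF bij, symmetric])
    also have "\<dots> = (\<Prod>i = 0..<?m. submatrix M I I $$ (i, p i))"
    proof (rule prod.cong[OF refl])
      fix i assume i: "i \<in> {0..<?m}"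
      then have "p i < ?m"
        using permutes_in_image[OF p, of i] by simp
      then show "M $$ (?f i, ?p (?f i)) = submatrix M I I $$ (i, p i)"
        using i M eq map_permutation_apply[OF inj i] by (simp add: submatrix_index)
    qed
    finally show "signof ?p * (\<Prod>i\<in>I. M $$ (i, ?p i)) =
        signof p * (\<Prod>i = 0..<?m. submatrix M I I $$ (i, p i))"
      using sign_map_permutation[OF inj p] by simp
  next
    fix p assume "p \<in> {p. p permutes I}"
    then have p: "p permutes I" by simp
    show "map_permutation {0..<?m} ?f (map_permutation I ?g p) = p"
      using map_permutation_compose_inv[OF bij' p, of ?f] img by (simp add: f_inv_into_f)
    show "map_permutation I ?g p \<in> {p. p permutes {0..<?m}}"
      using map_permutation_permutes[OF bij' p] by simp
  qed
  also have "\<dots> = det (principal_mask M I)"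
    using det_principal_mask_sum[OF M I] by simp
  finally show ?thesis .
qed

section \<open>Nonnegative diagonal perturbations and sign reversal\<close>

lemma det_add_mult_row:
  fixes A B C :: "'a :: comm_ring_1 mat"
  assumes A: "A \<in> carrier_mat n n" and B: "B \<in> carrier_mat n n" and C: "C \<in> carrier_mat n n"
    and k: "k < n"
    and off: "\<And>i j. i < n \<Longrightarrow> j < n \<Longrightarrow> i \<noteq> k \<Longrightarrow> B $$ (i, j) = A $$ (i, j) \<and> C $$ (i, j) = A $$ (i, j)"
    and row: "\<And>j. j < n \<Longrightarrow> A $$ (k, j) = B $$ (k, j) + c * C $$ (k, j)"
  shows "det A = det B + c * det C"
proof -
  \<comment> \<open>The matrices differ in row \<open>k\<close> only, so the cofactors along this
    row agree.\<close>
  have "mat_delete B k j = mat_delete A k j" "mat_delete C k j = mat_delete A k j" for j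
    unfolding mat_delete_def using A B C off by (auto intro!: eq_matI)
  then have "cofactor B k j = cofactor A k j" "cofactor C k j = cofactor A k j" for j
    by (simp_all add: cofactor_def)
  then show ?thesis
    unfolding laplace_expansion_row[OF A k] laplace_expansion_row[OF B k]
      laplace_expansion_row[OF C k]
    by (simp add: row sum.distrib sum_distrib_left algebra_simps)
qed

lemma det_principal_mask_pos:
  assumes M: "M \<in> carrier_mat n n" and P: "P_matrix M" and I: "I \<subseteq> {..<n}"
  shows "det (principal_mask M I) > 0"
proof (cases "I = {}")
  case True
  then have "principal_mask M I = 1\<^sub>m n"
    using M by (auto simp: principal_mask_def)
  then show ?thesis by simp
next
  case False
  then show ?thesis
    using P I M det_submatrix_eq_det_principal_mask[OF M I] by (auto simp: P_matrix_def)
qed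

text \<open>Minors are affine in each diagonal entry: adding \<open>d k\<close> at position
  \<open>k\<close> of \<open>I\<close> adds \<open>d k\<close> times the minor of
  \<open>I - {k}\<close>. Since this smaller minor enters, the induction on \<open>J\<close> keeps
  \<open>I\<close> arbitrary.\<close>

lemma det_principal_mask_add_diag_pos:
  fixes d :: "nat \<Rightarrow> real"
  assumes M: "M \<in> carrier_mat n n" and P: "P_matrix M" and d: "\<And>i. d i \<ge> 0"
    and J: "finite J" and I: "I \<subseteq> {..<n}"
  shows "det (principal_mask (M + mat n n (\<lambda>(i, j). if i = j \<and> i \<in> J then d i else 0)) I) > 0"
proof -
  define A where "A K = M + mat n n (\<lambda>(i, j). if i = j \<and> i \<in> K then d i else 0)" for K
  have A: "A K \<in> carrier_mat n n" for K
    using M by (simp add: A_def)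
  have ix: "principal_mask (A K) L $$ (i, j) =
      (if i \<in> L then M $$ (i, j) + (if i = j \<and> i \<in> K then d i else 0) else if i = j then 1 else 0)"
    if "i < n" "j < n" for i j K L
    using M that unfolding index_principal_mask[OF A that] by (auto simp: A_def)
  have "det (principal_mask (A J) I) > 0"
    using J I
  proof (induction J arbitrary: I rule: finite_induct)
    case empty
    have "A {} = M"
      using M by (intro eq_matI) (auto simp: A_def)
    then show ?case
      using det_principal_mask_pos[OF M P empty] by simp
  next
    case (insert k J)
    show ?case
    proof (cases "k \<in> I")
      case True
      have k: "k < n"
        using True insert.prems by auto
      have "det (principal_mask (A (insert k J)) I) =
          det (principal_mask (A J) I) + d k * det (principal_mask (A J) (I - {k}))"
        using True k insert.hyps
        by (intro det_add_mult_row[of _ n _ _ k] principal_mask_carrier A) (auto simp: ix)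
      moreover have "det (principal_mask (A J) I) > 0"
        "det (principal_mask (A J) (I - {k})) > 0"
        using insert.prems by (auto intro!: insert.IH)
      ultimately show ?thesis
        using d[of k] by (simp add: add_pos_nonneg)
    next
      \<comment> \<open>Row \<open>k\<close> is masked by a unit row, which hides the change on the
        diagonal.\<close>
      case False
      have "principal_mask (A (insert k J)) I = principal_mask (A J) I"
        using False
        by (intro eq_matI) (auto simp: ix carrier_matD[OF principal_mask_carrier[OF A]])
      then show ?thesis
        using insert by simp
    qed
  qed
  then show ?thesis
    by (simp add: A_def)
qed

text \<open>If \<open>x\<^sub>i (M x)\<^sub>i \<le> 0\<close> for all \<open>i\<close>, then adding suitable nonnegative numbers to the diagonal
  of \<open>M\<close> puts \<open>x\<close> into the kernel of the rows indexed by its support.\<close>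

lemma P_matrix_sign_reversal:
  assumes M: "M \<in> carrier_mat n n" and P: "P_matrix M" and x: "x \<in> carrier_vec n"
    and le: "\<And>i. i < n \<Longrightarrow> x $ i * (M *\<^sub>v x) $ i \<le> 0"
  shows "x = 0\<^sub>v n"
proof (rule ccontr)
  assume nz: "x \<noteq> 0\<^sub>v n"
  define I where "I = {i. i < n \<and> x $ i \<noteq> 0}"
  define d where "d i = (if i \<in> I then - ((M *\<^sub>v x) $ i / x $ i) else 0)" for i
  let ?D = "mat n n (\<lambda>(i, j). if i = j \<and> i \<in> I then d i else 0)"
  let ?A = "principal_mask (M + ?D) I"
  have MD: "M + ?D \<in> carrier_mat n n"
    using M by simp
  have A: "?A \<in> carrier_mat n n"
    using MD by simp
  have "d i \<ge> 0" for i
    using le[of i] by (auto simp: d_def I_def divide_le_0_iff mult_le_0_iff)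
  then have "det ?A > 0"
    using det_principal_mask_add_diag_pos[OF M P, of d I I] by (auto simp: I_def)
  moreover have "?A *\<^sub>v x = 0\<^sub>v n"
  proof (rule eq_vecI)
    fix i assume "i < dim_vec (0\<^sub>v n)"
    then have i: "i < n" by simp
    have "(?A *\<^sub>v x) $ i = (\<Sum>j\<in>{0..<n}. ?A $$ (i, j) * x $ j)"
      using i A x by (simp add: scalar_prod_def carrier_matD[OF A] del: index_mat)
    also have "\<dots> = 0"
    proof (cases "i \<in> I")
      case True
      have "(\<Sum>j\<in>{0..<n}. ?A $$ (i, j) * x $ j) =
          (\<Sum>j\<in>{0..<n}. M $$ (i, j) * x $ j + (if j = i then d i * x $ i else 0))"
        using True i M by (intro sum.cong) (auto simp: index_principal_mask[OF MD] algebra_simps)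
      also have "\<dots> = (M *\<^sub>v x) $ i + d i * x $ i"
        using i M x by (auto simp: scalar_prod_def sum.distrib)
      also have "\<dots> = 0"
        using True by (simp add: d_def I_def)
      finally show ?thesis .
    next
      case False
      then have "x $ i = 0"
        using i by (simp add: I_def)
      then show ?thesis
        using False i by (intro sum.neutral) (auto simp: index_principal_mask[OF MD])
    qed
    finally show "(?A *\<^sub>v x) $ i = 0\<^sub>v n $ i"
      using i by simp
  qed (simp add: carrier_matD[OF A])
  ultimately show False
    using det_0_iff_vec_prod_zero_field[OF A] x nz by auto
qed

section \<open>Bases\<close>

text \<open>For \<open>x = basis_vec M q B\<close>, this and \<open>basis_z\<close> are the pair
  w(B), z(B) of the basis.\<close>

definition basis_w :: "nat set \<Rightarrow> real vec \<Rightarrow> real vec" where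
  "basis_w B x = vec (dim_vec x) (\<lambda>i. if i \<in> B then 0 else x $ i)"

definition basis_z :: "nat set \<Rightarrow> real vec \<Rightarrow> real vec" where
  "basis_z B x = vec (dim_vec x) (\<lambda>i. if i \<in> B then x $ i else 0)"

lemma basis_w_z_carrier [simp]:
  "x \<in> carrier_vec n \<Longrightarrow> basis_w B x \<in> carrier_vec n"
  "x \<in> carrier_vec n \<Longrightarrow> basis_z B x \<in> carrier_vec n"
  by (auto simp: basis_w_def basis_z_def)

lemma basis_mat_carrier [simp]: "M \<in> carrier_mat n n \<Longrightarrow> basis_mat M B \<in> carrier_mat n n"
  by (auto simp: basis_mat_def)

text \<open>Passes from the square system of a basis to the form w - M z, to which sign reversal
  applies.\<close>

lemma basis_mat_mult_vec:
  assumes M: "M \<in> carrier_mat n n" and x: "x \<in> carrier_vec n"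
  shows "basis_mat M B *\<^sub>v x = basis_w B x - M *\<^sub>v basis_z B x"
proof (rule eq_vecI)
  fix i assume "i < dim_vec (basis_w B x - M *\<^sub>v basis_z B x)"
  then have i: "i < n" using M by simp
  have "(basis_mat M B *\<^sub>v x) $ i = (\<Sum>j\<in>{0..<n}. basis_mat M B $$ (i, j) * x $ j)"
    using i M x by (auto simp: scalar_prod_def basis_mat_def)
  also have "\<dots> = (\<Sum>j\<in>{0..<n}. (if j = i then basis_w B x $ i else 0) - M $$ (i, j) * basis_z B x $ j)"
    using i M x by (intro sum.cong) (auto simp: basis_mat_def basis_w_def basis_z_def)
  also have "\<dots> = (basis_w B x - M *\<^sub>v basis_z B x) $ i"
    using i M x by (auto simp: scalar_prod_def sum_subtractf basis_w_def basis_z_def)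
  finally show "(basis_mat M B *\<^sub>v x) $ i = (basis_w B x - M *\<^sub>v basis_z B x) $ i" .
qed (use M x in \<open>auto simp: basis_mat_def\<close>)

text \<open>A kernel vector yields w = M z with \<open>w\<^sub>i z\<^sub>i = 0\<close> for all i.
  Sign reversal gives z = 0, and then w = 0.\<close>

lemma det_basis_mat_nonzero:
  assumes M: "M \<in> carrier_mat n n" and P: "P_matrix M"
  shows "det (basis_mat M B) \<noteq> 0"
proof
  assume "det (basis_mat M B) = 0"
  then obtain x where x: "x \<in> carrier_vec n" "x \<noteq> 0\<^sub>v n" "basis_mat M B *\<^sub>v x = 0\<^sub>v n"
    using det_0_iff_vec_prod_zero_field[of "basis_mat M B" n] M by auto
  have "(basis_w B x - M *\<^sub>v basis_z B x) $ i = 0" if "i < n" for i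
    unfolding basis_mat_mult_vec[OF M x(1), of B, symmetric] x(3) using that by simp
  then have w: "basis_w B x $ i = (M *\<^sub>v basis_z B x) $ i" if "i < n" for i
    using that M by simp
  have z: "basis_z B x = 0\<^sub>v n"
  proof (rule P_matrix_sign_reversal[OF M P])
    fix i assume "i < n"
    then show "basis_z B x $ i * (M *\<^sub>v basis_z B x) $ i \<le> 0"
      using x(1) by (subst w[symmetric]) (auto simp: basis_w_def basis_z_def)
  qed (use x in simp)
  have "x $ i = 0" if "i < n" for i
  proof (cases "i \<in> B")
    case True
    then have "x $ i = basis_z B x $ i"
      using that x(1) by (simp add: basis_z_def)
    then show ?thesis
      using z that by simp
  next
    case False
    then have "x $ i = basis_w B x $ i"
      using that x(1) by (simp add: basis_w_def)
    then show ?thesis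
      using w[OF that] z that M by (simp add: scalar_prod_def)
  qed
  then have "x = 0\<^sub>v n"
    using x(1) by (intro eq_vecI) auto
  then show False
    using x(2) by simp
qed

text \<open>With a nonzero determinant \<open>mat_inverse\<close> returns a proper inverse. From
  here on \<open>basis_vec\<close> is handled as the unique solution of its system.\<close>

lemma
  assumes M: "M \<in> carrier_mat n n" and P: "P_matrix M" and q: "q \<in> carrier_vec n"
  shows basis_vec_carrier: "basis_vec M q B \<in> carrier_vec n"
    and basis_mat_mult_basis_vec: "basis_mat M B *\<^sub>v basis_vec M q B = q"
    and basis_vec_unique:
      "\<And>x. x \<in> carrier_vec n \<Longrightarrow> basis_mat M B *\<^sub>v x = q \<Longrightarrow> x = basis_vec M q B"
proof -
  let ?A = "basis_mat M B"
  have A: "?A \<in> carrier_mat n n"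
    using M by simp
  have "?A \<in> Units (ring_mat TYPE(real) n ())"
    using det_non_zero_imp_unit[OF A det_basis_mat_nonzero[OF M P]] .
  then obtain C where C: "mat_inverse ?A = Some C"
    using mat_inverse(1)[OF A, of "()"] by fastforce
  then have C': "?A * C = 1\<^sub>m n" "C * ?A = 1\<^sub>m n" "C \<in> carrier_mat n n"
    using mat_inverse(2)[OF A C] by auto
  have eq: "basis_vec M q B = C *\<^sub>v q"
    by (simp add: basis_vec_def C)
  show "basis_vec M q B \<in> carrier_vec n"
    using C' q by (simp add: eq)
  show "?A *\<^sub>v basis_vec M q B = q"
    unfolding eq using C' q A by (simp flip: assoc_mult_mat_vec)
  show "x = basis_vec M q B" if x: "x \<in> carrier_vec n" "?A *\<^sub>v x = q" for x
  proof -
    have "x = (C * ?A) *\<^sub>v x"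
      unfolding C'(2) using x(1) by simp
    also have "\<dots> = C *\<^sub>v (?A *\<^sub>v x)"
      using C'(3) A x(1) by (rule assoc_mult_mat_vec)
    finally show ?thesis
      unfolding x(2) eq .
  qed
qed

text \<open>The sign pattern determines the basis: where two bases with equal sign patterns differ,
  the solutions satisfy \<open>(z - z')\<^sub>i (w - w')\<^sub>i \<le> 0\<close>.\<close>

lemma inj_on_negative_indices:
  assumes M: "M \<in> carrier_mat n n" and P: "P_matrix M" and q: "q \<in> carrier_vec n"
    and nd: "nondegenerate M q"
  shows "inj_on (\<lambda>B. {i. i < n \<and> basis_vec M q B $ i < 0}) (Pow {..<n})"
proof (rule inj_onI)
  fix B B' assume B: "B \<in> Pow {..<n}" "B' \<in> Pow {..<n}"
    and eq: "{i. i < n \<and> basis_vec M q B $ i < 0} = {i. i < n \<and> basis_vec M q B' $ i < 0}"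
  let ?x = "basis_vec M q B" and ?y = "basis_vec M q B'"
  let ?u = "basis_z B ?x - basis_z B' ?y"
  note c [simp] = basis_vec_carrier[OF M P q] carrier_vecD[OF basis_vec_carrier[OF M P q]]
  have nz: "?x $ i \<noteq> 0" "?y $ i \<noteq> 0" if "i < n" for i
    using nd B that M by (auto simp: nondegenerate_def)
  have sgn: "?x $ i < 0 \<longleftrightarrow> ?y $ i < 0" if "i < n" for i
    using eq that by (auto simp: set_eq_iff)
  have u: "?u = 0\<^sub>v n"
  proof (rule P_matrix_sign_reversal[OF M P])
    fix i assume i: "i < n"
    have 1: "basis_w B ?x - M *\<^sub>v basis_z B ?x = q" "basis_w B' ?y - M *\<^sub>v basis_z B' ?y = q"
      using basis_mat_mult_vec[OF M c(1)] basis_mat_mult_basis_vec[OF M P q] by metis+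
    have "(basis_w B ?x - M *\<^sub>v basis_z B ?x) $ i = (basis_w B' ?y - M *\<^sub>v basis_z B' ?y) $ i"
      unfolding 1 ..
    then have "basis_w B ?x $ i - basis_w B' ?y $ i =
        (M *\<^sub>v basis_z B ?x) $ i - (M *\<^sub>v basis_z B' ?y) $ i"
      using i M by simp
    also have "\<dots> = (M *\<^sub>v ?u) $ i"
      using i M by (subst mult_minus_distrib_mat_vec[OF M]) auto
    finally have "(M *\<^sub>v ?u) $ i = basis_w B ?x $ i - basis_w B' ?y $ i" ..
    \<comment> \<open>If \<open>i\<close> lies in exactly one of the bases, the product is
      \<open>- (?x $ i * ?y $ i)\<close>, and both entries have the same sign. Otherwise one factor
      is 0.\<close>
    then show "?u $ i * (M *\<^sub>v ?u) $ i \<le> 0"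
      using i sgn[OF i] nz[OF i]
      by (auto simp: basis_w_def basis_z_def mult_le_0_iff)
  qed simp
  \<comment> \<open>By nondegeneracy each basis is the support of its z-part, and the z-parts
    agree.\<close>
  have "i \<in> B \<longleftrightarrow> i \<in> B'" if i: "i < n" for i
  proof -
    have "basis_z B ?x $ i = basis_z B' ?y $ i"
      using arg_cong[OF u, of "\<lambda>v. v $ i"] i by (simp add: basis_z_def)
    then show ?thesis
      using i nz[OF i] by (auto simp: basis_z_def split: if_splits)
  qed
  then show "B = B'"
    using B by blast
qed

lemma ex1_optimal_basis:
  assumes M: "M \<in> carrier_mat n n" and P: "P_matrix M" and q: "q \<in> carrier_vec n"
    and nd: "nondegenerate M q"
  shows "\<exists>!B. optimal_basis M q B"
proof -
  let ?s = "\<lambda>B. {i. i < n \<and> basis_vec M q B $ i < 0}"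
  have inj: "inj_on ?s (Pow {..<n})"
    by (rule inj_on_negative_indices[OF assms])
  have iff: "optimal_basis M q B \<longleftrightarrow> B \<in> Pow {..<n} \<and> ?s B = {}" for B
    using M basis_vec_carrier[OF M P q, of B]
    by (auto simp: optimal_basis_def less_eq_vec_def)
  have "?s ` Pow {..<n} = Pow {..<n}"
    by (rule endo_inj_surj[OF _ _ inj]) auto
  then obtain B where "B \<in> Pow {..<n}" "?s B = {}"
    by (metis (no_types, lifting) Pow_bottom imageE)
  then show ?thesis
    unfolding iff using inj_onD[OF inj] by (intro ex1I[of _ B]) metis+
qed

section \<open>Leading subproblems\<close>

lemma leading_mat_carrier [simp]: "leading_mat k M \<in> carrier_mat k k"
  by (simp add: leading_mat_def)

lemma leading_mat_self: "M \<in> carrier_mat n n \<Longrightarrow> leading_mat n M = M"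
  by (auto simp: leading_mat_def)

lemma vec_first_self: "v \<in> carrier_vec n \<Longrightarrow> vec_first v n = v"
  by (auto simp: vec_first_def)

lemma P_matrix_leading_mat:
  assumes M: "M \<in> carrier_mat n n" and P: "P_matrix M" and k: "k \<le> n"
  shows "P_matrix (leading_mat k M)"
  unfolding P_matrix_def
proof (intro conjI allI impI)
  show "square_mat (leading_mat k M)"
    by (simp add: leading_mat_def)
  fix I assume I: "I \<noteq> {} \<and> I \<subseteq> {..<dim_row (leading_mat k M)}"
  then have Ik: "I \<subseteq> {..<k}" by (simp add: leading_mat_def)
  then have eq: "{i. i < k \<and> i \<in> I} = I" "{i. i < n \<and> i \<in> I} = I"
    using k by auto
  have "submatrix (leading_mat k M) I I = submatrix M I I"
  proof (rule eq_matI)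
    fix i j assume "i < dim_row (submatrix M I I)" "j < dim_col (submatrix M I I)"
    then have ij: "i < card I" "j < card I"
      using M eq by (auto simp: dim_submatrix)
    then have "pick I i < k" "pick I j < k"
      using pick_in_set_le Ik by blast+
    then show "submatrix (leading_mat k M) I I $$ (i, j) = submatrix M I I $$ (i, j)"
      using ij M eq by (simp add: submatrix_index leading_mat_def)
  qed (use M eq in \<open>simp_all add: dim_submatrix leading_mat_def\<close>)
  moreover have "det (submatrix M I I) > 0"
    using P M I order_trans[OF Ik, of "{..<n}"] k by (auto simp: P_matrix_def)
  ultimately show "det (submatrix (leading_mat k M) I I) > 0"
    by simp
qed

text \<open>In the first \<open>l\<close> rows, nonbasic columns from \<open>l\<close> on are parts
  of unit columns and vanish; \<open>zero\<close> says the same of the basic ones. So the first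
  \<open>l\<close> equations form a closed system, solved by the truncated vector.\<close>

lemma basis_vec_leading_mat:
  assumes M: "M \<in> carrier_mat n n" and P: "P_matrix M" and q: "q \<in> carrier_vec n"
    and l: "l \<le> n"
    and zero: "\<And>i j. i < l \<Longrightarrow> l \<le> j \<Longrightarrow> j < n \<Longrightarrow> j \<in> B \<Longrightarrow> M $$ (i, j) = 0"
  shows "basis_vec (leading_mat l M) (vec_first q l) (B \<inter> {..<l}) = vec_first (basis_vec M q B) l"
proof (rule basis_vec_unique[OF leading_mat_carrier P_matrix_leading_mat[OF M P l]
      vec_first_carrier vec_first_carrier, symmetric])
  let ?x = "basis_vec M q B"
  note x = basis_vec_carrier[OF M P q, of B]
  show "basis_mat (leading_mat l M) (B \<inter> {..<l}) *\<^sub>v vec_first ?x l = vec_first q l"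
  proof (rule eq_vecI)
    fix i assume "i < dim_vec (vec_first q l)"
    then have i: "i < l" by simp
    have "(basis_mat (leading_mat l M) (B \<inter> {..<l}) *\<^sub>v vec_first ?x l) $ i =
        (\<Sum>j\<in>{0..<l}. basis_mat (leading_mat l M) (B \<inter> {..<l}) $$ (i, j) * vec_first ?x l $ j)"
      using i by (auto simp: scalar_prod_def basis_mat_def leading_mat_def vec_first_def)
    also have "\<dots> = (\<Sum>j\<in>{0..<l}. basis_mat M B $$ (i, j) * ?x $ j)"
      using i l M by (intro sum.cong) (auto simp: basis_mat_def leading_mat_def vec_first_def)
    also have "\<dots> = (\<Sum>j\<in>{0..<n}. basis_mat M B $$ (i, j) * ?x $ j)"
      using i l M zero by (intro sum.mono_neutral_left) (auto simp: basis_mat_def)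
    also have "\<dots> = (basis_mat M B *\<^sub>v ?x) $ i"
      using i l M x by (auto simp: scalar_prod_def basis_mat_def)
    also have "\<dots> = q $ i"
      using basis_mat_mult_basis_vec[OF M P q] by simp
    finally show "(basis_mat (leading_mat l M) (B \<inter> {..<l}) *\<^sub>v vec_first ?x l) $ i =
        vec_first q l $ i"
      using i by (simp add: vec_first_def)
  qed (simp add: basis_mat_def leading_mat_def)
qed

text \<open>A basis inside \<open>[k]\<close> has no basic column from \<open>k\<close> on, so its
  vector in the subproblem is a prefix of its vector in the full problem.\<close>

lemma nondegenerate_leading:
  assumes M: "M \<in> carrier_mat n n" and P: "P_matrix M" and q: "q \<in> carrier_vec n"
    and nd: "nondegenerate M q" and k: "k \<le> n"
  shows "nondegenerate (leading_mat k M) (vec_first q k)"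
  unfolding nondegenerate_def
proof (intro allI impI)
  fix B i assume "B \<subseteq> {..<dim_row (leading_mat k M)}" "i < dim_row (leading_mat k M)"
  then have B: "B \<subseteq> {..<k}" and i: "i < k"
    by (auto simp: leading_mat_def)
  then have "basis_vec (leading_mat k M) (vec_first q k) (B \<inter> {..<k}) = vec_first (basis_vec M q B) k"
    by (intro basis_vec_leading_mat[OF M P q k]) auto
  moreover have "B \<inter> {..<k} = B"
    using B by auto
  ultimately show "basis_vec (leading_mat k M) (vec_first q k) B $ i \<noteq> 0"
    using nd[unfolded nondegenerate_def, rule_format, of B i] order_trans[OF B, of "{..<n}"] i k M
    by (auto simp: vec_first_def)
qed

text \<open>Discharges the description operator in \<open>opt_basis\<close>: a test at size
  \<open>k\<close> succeeds for B(k) and for nothing else.\<close>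

lemma optimal_basis_leading_iff:
  assumes "M \<in> carrier_mat n n" "P_matrix M" "q \<in> carrier_vec n" "nondegenerate M q" "k \<le> n"
  shows "optimal_basis (leading_mat k M) (vec_first q k) B \<longleftrightarrow> B = opt_basis M q k"
proof -
  have "\<exists>!B. optimal_basis (leading_mat k M) (vec_first q k) B"
    using assms
    by (intro ex1_optimal_basis[of _ k] nondegenerate_leading P_matrix_leading_mat) auto
  then show ?thesis
    unfolding opt_basis_def by (metis (mono_tags, lifting) theI)
qed

text \<open>Column \<open>j\<close> of a lower Hessenberg matrix vanishes in the rows \<open>i < j - 1\<close>, so if \<open>l\<close> is
  nonbasic, then none of the basic columns \<open>j \<ge> l\<close> occurs in the first \<open>l\<close> equations.\<close>

lemma optimal_basis_leading_Hessenberg: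
  assumes M: "M \<in> carrier_mat n n" and P: "P_matrix M" and q: "q \<in> carrier_vec n"
    and H: "lower_Hessenberg M" and opt: "optimal_basis M q B" and l: "l \<le> n" "l \<notin> B"
  shows "optimal_basis (leading_mat l M) (vec_first q l) (B \<inter> {..<l})"
proof -
  have "basis_vec (leading_mat l M) (vec_first q l) (B \<inter> {..<l}) = vec_first (basis_vec M q B) l"
  proof (rule basis_vec_leading_mat[OF M P q l(1)])
    fix i j assume ij: "i < l" "l \<le> j" "j < n" "j \<in> B"
    moreover have "j \<noteq> l"
      using ij l by auto
    ultimately show "M $$ (i, j) = 0"
      using H M by (auto simp: lower_Hessenberg_def)
  qed
  then show ?thesis
    using opt M l basis_vec_carrier[OF M P q, of B]
    by (auto simp: optimal_basis_def leading_mat_def vec_first_def less_eq_vec_def)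
qed

lemma leading_mat_leading_mat: "l \<le> k \<Longrightarrow> leading_mat l (leading_mat k M) = leading_mat l M"
  by (auto simp: leading_mat_def)

lemma vec_first_vec_first: "l \<le> k \<Longrightarrow> vec_first (vec_first q k) l = vec_first q l"
  by (auto simp: vec_first_def)

lemma lower_Hessenberg_leading_mat:
  "M \<in> carrier_mat n n \<Longrightarrow> lower_Hessenberg M \<Longrightarrow> k \<le> n \<Longrightarrow> lower_Hessenberg (leading_mat k M)"
  by (auto simp: lower_Hessenberg_def leading_mat_def)

lemma opt_basis_cases:
  assumes M: "M \<in> carrier_mat n n" and P: "P_matrix M" and q: "q \<in> carrier_vec n"
    and nd: "nondegenerate M q" and H: "lower_Hessenberg M" and k: "k \<le> n"
    and neq: "opt_basis M q k \<noteq> {..<k}"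
  shows "\<exists>l<k. opt_basis M q k = opt_basis M q l \<union> {l<..<k}"
proof -
  let ?B = "opt_basis M q k"
  have opt: "optimal_basis (leading_mat k M) (vec_first q k) ?B"
    using optimal_basis_leading_iff[OF M P q nd k] by simp
  then have sub: "?B \<subseteq> {..<k}"
    by (simp add: optimal_basis_def leading_mat_def)
  let ?N = "{..<k} - ?B"
  have N: "finite ?N" "?N \<noteq> {}"
    using sub neq by auto
  \<comment> \<open>As indices start at 0, \<open>l\<close> is both the largest nonbasic index and
    the size of the subproblem before it.\<close>
  define l where "l = Max ?N"
  have l: "l \<in> ?N"
    unfolding l_def using N by (rule Max_in)
  have above: "j \<in> ?B" if "l < j" "j < k" for j
    using Max_ge[OF N(1), of j] that unfolding l_def by (metis DiffI lessThan_iff not_less)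
  have "optimal_basis (leading_mat l (leading_mat k M)) (vec_first (vec_first q k) l) (?B \<inter> {..<l})"
    using l k M
    by (intro optimal_basis_leading_Hessenberg[OF leading_mat_carrier P_matrix_leading_mat[OF M P k]
          vec_first_carrier lower_Hessenberg_leading_mat[OF M H k] opt]) auto
  then have "?B \<inter> {..<l} = opt_basis M q l"
    using l k optimal_basis_leading_iff[OF M P q nd, of l]
    by (simp add: leading_mat_leading_mat vec_first_vec_first)
  moreover have "?B = (?B \<inter> {..<l}) \<union> {l<..<k}"
    using l sub above by (auto simp: subset_iff) (metis linorder_neqE_nat)
  ultimately show ?thesis
    using l by auto
qed

section \<open>The algorithm\<close>

text \<open>Continuation style, because each outcome of a test needs its own copy of the remaining
  decision tree. \<open>D\<close> is adopted untested once all candidates have failed.\<close>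

fun search :: "nat \<Rightarrow> nat set list \<Rightarrow> nat set \<Rightarrow> (nat set \<Rightarrow> test_algorithm) \<Rightarrow> test_algorithm" where
  "search k [] D cont = cont D"
| "search k (C # Cs) D cont = Test k C (cont C) (search k Cs D cont)"

text \<open>In \<open>solve m Bs\<close>, the list \<open>Bs\<close> holds \<open>B(0), \<dots>, B(k - 1)\<close> and \<open>m\<close> is the number of
  leading subproblems that are still to be solved. The last candidate \<open>[k]\<close> needs no test.\<close>

fun solve :: "nat \<Rightarrow> nat set list \<Rightarrow> test_algorithm" where
  "solve 0 Bs = Output (last Bs)"
| "solve (Suc m) Bs =
     search (length Bs) (map (\<lambda>l. Bs ! l \<union> {l<..<length Bs}) [0..<length Bs]) {..<length Bs}
       (\<lambda>B. solve m (Bs @ [B]))"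

lemma num_tests_search:
  "(\<And>B. num_tests (cont B) t \<le> c) \<Longrightarrow> num_tests (search k Cs D cont) t \<le> length Cs + c"
  by (induction Cs) (auto simp: le_SucI trans_le_add2)

text \<open>The stage for size k has k candidates to test. The bound holds for every answer function
  \<open>t\<close>.\<close>

lemma num_tests_solve: "num_tests (solve m Bs) t \<le> \<Sum>{length Bs..<length Bs + m}"
proof (induction m arbitrary: Bs)
  case (Suc m)
  have "num_tests (solve m (Bs @ [B])) t \<le> \<Sum>{Suc (length Bs)..<length Bs + Suc m}" for B
    using Suc[of "Bs @ [B]"] by simp
  then have "num_tests (solve (Suc m) Bs) t \<le>
      length Bs + \<Sum>{Suc (length Bs)..<length Bs + Suc m}"
    unfolding solve.simps by (rule num_tests_search[THEN order_trans]) simp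
  also have "\<dots> = \<Sum>{length Bs..<length Bs + Suc m}"
    by (rule sum.atLeast_Suc_lessThan[symmetric]) simp
  finally show ?case .
qed simp

text \<open>Only \<open>B0\<close> passes a test, so the search stops at its first occurrence; if it
  is not in the list, all tests fail and the default \<open>D\<close> must be
  \<open>B0\<close>.\<close>

lemma run_search:
  assumes "\<And>B. t k B \<longleftrightarrow> B = B0" and "B0 \<in> insert D (set Cs)"
  shows "run (search k Cs D cont) t = run (cont B0) t"
  using assms by (induction Cs) auto

text \<open>The invariant is that the list holds the correct bases B(0), ..., B(k - 1). It ends with
  \<open>Suc n\<close> entries, the last being B(n).\<close>

lemma run_solve:
  assumes M: "M \<in> carrier_mat n n" and P: "P_matrix M" and q: "q \<in> carrier_vec n"
    and nd: "nondegenerate M q" and H: "lower_Hessenberg M"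
    and "k > 0" "k + m = Suc n"
  shows "run (solve m (map (opt_basis M q) [0..<k])) (basis_test M q) = opt_basis M q n"
  using assms(6-)
proof (induction m arbitrary: k)
  case 0
  then show ?case
    by (simp add: last_map)
next
  case (Suc m)
  let ?Bs = "map (opt_basis M q) [0..<k]"
  have k: "k \<le> n"
    using Suc.prems by simp
  have test: "basis_test M q k B \<longleftrightarrow> B = opt_basis M q k" for B
    using k M optimal_basis_leading_iff[OF M P q nd k] by (simp add: basis_test_def)
  have "opt_basis M q k \<in> insert {..<k} (set (map (\<lambda>l. ?Bs ! l \<union> {l<..<k}) [0..<k]))"
    using opt_basis_cases[OF M P q nd H k] by (fastforce simp: image_iff)
  then have "run (solve (Suc m) ?Bs) (basis_test M q) =
      run (solve m (?Bs @ [opt_basis M q k])) (basis_test M q)"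
    unfolding solve.simps
    by (subst run_search[where ?B0.0 = "opt_basis M q k"]) (simp_all add: test)
  also have "?Bs @ [opt_basis M q k] = map (opt_basis M q) [0..<Suc k]"
    by simp
  also have "run (solve m \<dots>) (basis_test M q) = opt_basis M q n"
    using Suc.prems by (intro Suc.IH) auto
  finally show ?case .
qed

text \<open>The empty problem has only the empty basis, which starts the list without any
  test.\<close>

lemma opt_basis_0:
  assumes "M \<in> carrier_mat n n" "P_matrix M" "q \<in> carrier_vec n" "nondegenerate M q"
  shows "opt_basis M q 0 = {}"
  using optimal_basis_leading_iff[OF assms, of 0 "opt_basis M q 0"]
  by (auto simp: optimal_basis_def leading_mat_def)

theorem theorem5p1:
  fixes n :: nat
  shows "\<exists>alg. \<forall>M q.
    M \<in> carrier_mat n n \<and> q \<in> carrier_vec n \<and>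
    lower_Hessenberg M \<and> P_matrix M \<and> nondegenerate M q \<longrightarrow>
      optimal_basis M q (run alg (basis_test M q)) \<and>
      run alg (basis_test M q) = opt_basis M q n \<and>
      num_tests alg (basis_test M q) \<le> (n + 1) choose 2"
proof (intro exI[of _ "solve n [{}]"] allI impI, elim conjE)
  fix M :: "real mat" and q
  assume M: "M \<in> carrier_mat n n" and q: "q \<in> carrier_vec n" and H: "lower_Hessenberg M"
    and P: "P_matrix M" and nd: "nondegenerate M q"
  \<comment> \<open>The tree depends on \<open>n\<close> alone. Its initial list holds only B(0), so
    the invariant is entered at \<open>k = 1\<close> with \<open>n\<close> stages left.\<close>
  have run: "run (solve n [{}]) (basis_test M q) = opt_basis M q n"
    using run_solve[OF M P q nd H, of 1 n] opt_basis_0[OF M P q nd] by simp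
  moreover have "optimal_basis M q (opt_basis M q n)"
    using optimal_basis_leading_iff[OF M P q nd order_refl]
    by (simp add: leading_mat_self[OF M] vec_first_self[OF q])
  moreover have "\<Sum>{1..<1 + n} = (n + 1) choose 2"
    by (induction n) (simp_all add: numeral_2_eq_2)
  then have "num_tests (solve n [{}]) (basis_test M q) \<le> (n + 1) choose 2"
    using num_tests_solve[of n "[{}]" "basis_test M q"] by simp
  ultimately show "optimal_basis M q (run (solve n [{}]) (basis_test M q)) \<and>
      run (solve n [{}]) (basis_test M q) = opt_basis M q n \<and>
      num_tests (solve n [{}]) (basis_test M q) \<le> (n + 1) choose 2"
    by simp
qed

end
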